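(* Let $(\Sigma,\mathcal T,\eta)$ be a weighted triangulated surface with boundary carrying a mixed discrete conformal structure II on $\Omega(\eta)$. Suppose one of the following holds: (1) all right-angled hyperbolic hexagons are Type-II, and for each of them (with distinguished component $i$) $\eta_{ij}\in[0,+\infty)$, $\eta_{ik}\in[0,+\infty)$, $\eta_{jk}\in(-1,+\infty)$; (2) not all hexagons are Type-II; for each Type-II hexagon (with distinguished component $i$) $\eta_{ij}\in[0,+\infty)$, $\eta_{ik}\in[0,+\infty)$, $\eta_{jk}\in(-1,+\infty)$, and for each hexagon all of whose edges are of kind (A2), $\eta\in(-1,+\infty)$ on its edges. Then the discrete conformal factor $f\in\Omega(\eta)$ is uniquely determined by its generalized combinatorial curvature $K\in\mathbb R^N_{>0}$ (the map $f\mapsto K$ is injective on $\Omega(\eta)$).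
   Context: $\Sigma$ is a compact surface with boundary components indexed by $B=\{1,\dots,N\}$, obtained from a triangulated closed surface with $N$ vertices by removing small disjoint open disk neighbourhoods of the vertices; $\mathcal T$ is the induced ideal triangulation with ideal edges $\{ij\}\in E$, oriented edges $E_+$, and hexagonal ideal faces $\{ijk\}\in F$. Given $l\in\mathbb R^E_{>0}$, the face $\{ijk\}$ is the right-angled hyperbolic hexagon with three pairwise non-adjacent sides $l_{ij},l_{jk},l_{ki}$, and $\theta_i^{jk}>0$ is the length of its side at $i$: $\cosh\theta_i^{jk}=\frac{\cosh l_{jk}+\cosh l_{ij}\cosh l_{ik}}{\sinh l_{ij}\sinh l_{ik}}$. $K_i=\sum_{\{ijk\}\in F}\theta_i^{jk}$. A discrete conformal structure is a smooth map $f\mapsto d(f)\in\mathbb R^{E_+}$ on the admissible space $\Omega(\eta)\subseteq\mathbb R^N$ with $l_{ij}=d_{ij}+d_{ji}>0$, $\sinh d_{ij}\sinh d_{jk}\sinh d_{ki}=\sinh d_{ji}\sinh d_{kj}\sinh d_{ik}$ on each face, $\partial l_{ij}/\partial f_i=\coth d_{ij}$, and $\partial d_{ij}/\partial f_k=0$ for $k\ne i,j$. Mixed II (with $\alpha\equiv-1$): all $f_i>0$; each edge is of kind (A2): $\frac{\sinh d_{ij}}{\sinh d_{ji}}=\sqrt{\frac{e^{2f_i}-1}{e^{2f_j}-1}}$, $\cosh l_{ij}=\sqrt{(e^{2f_i}-1)(e^{2f_j}-1)}+\eta_{ij}e^{f_i+f_j}$; or (B2): $\frac{\sinh d_{ij}}{\sinh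 d_{ji}}=-\sqrt{\frac{e^{2f_i}-1}{e^{2f_j}-1}}$, $\cosh l_{ij}=-\sqrt{(e^{2f_i}-1)(e^{2f_j}-1)}+\eta_{ij}e^{f_i+f_j}$; at least one edge is of kind (B2); and every face either has all edges of kind (A2) or is Type-II: it has a distinguished component $i$ with $d_{ij},d_{ik}<0$, $d_{ji},d_{ki},d_{jk},d_{kj}>0$, edges $\{ij\},\{ik\}$ of kind (B2) and $\{jk\}$ of kind (A2). $\Omega(\eta)$ is the set of $f\in\mathbb R^N_{>0}$ such that the right-hand side of the formula for $\cosh l_{ij}$ is $>1$ for every edge. *)

theory Defs
  imports "HOL-Analysis.Analysis"
begin

section \<open>Triangulated closed surfaces\<close>

text \<open>A triangulation is given by its set \<open>F\<close> of triangles, each one the set of its three vertices.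
  The vertex type \<open>'n\<close> is the index set \<open>B\<close> of the boundary components, so \<open>N = CARD('n)\<close>.
  Removing a disk neighbourhood of every vertex turns the triangles of \<open>F\<close> into the hexagonal
  ideal faces and the edges of \<open>F\<close> into the ideal edges, with the same labels.\<close>

definition edges :: "'n set set \<Rightarrow> 'n set set" where
  "edges F = {e. card e = 2 \<and> (\<exists>t\<in>F. e \<subseteq> t)}"

text \<open>The complex is a closed surface iff all vertex links are cycles. Two triangles at every edge
  make every link 2-regular, so a link is a cycle iff it is connected.\<close>

definition closed_surface_triangulation :: "'n::finite set set \<Rightarrow> bool" where
  "closed_surface_triangulation F \<longleftrightarrow>
     (\<forall>t\<in>F. card t = 3) \<and> \<Union>F = UNIV \<and>
     (\<forall>e\<in>edges F. card {t\<in>F. e \<subseteq> t} = 2) \<and>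
     (\<forall>v a b. {v, a} \<in> edges F \<longrightarrow> {v, b} \<in> edges F \<longrightarrow> (a, b) \<in> {(x, y). {v, x, y} \<in> F}\<^sup>*)"

section \<open>Hexagons and generalized combinatorial curvature\<close>

text \<open>\<open>theta l i j k\<close> is the side at \<open>i\<close> of the right-angled hyperbolic hexagon \<open>ijk\<close>;
  \<open>arcosh\<close> selects the positive solution of the cosine law.\<close>

definition theta :: "('n \<Rightarrow> 'n \<Rightarrow> real) \<Rightarrow> 'n \<Rightarrow> 'n \<Rightarrow> 'n \<Rightarrow> real" where
  "theta l i j k =
     arcosh ((cosh (l j k) + cosh (l i j) * cosh (l i k)) / (sinh (l i j) * sinh (l i k)))"

text \<open>The factor 1/2: every face \<open>{i, j, k}\<close> at \<open>i\<close> is listed as \<open>(j, k)\<close> and as \<open>(k, j)\<close>,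
  with the same value of \<open>theta\<close>.\<close>

definition curvature :: "'n::finite set set \<Rightarrow> ('n \<Rightarrow> 'n \<Rightarrow> real) \<Rightarrow> 'n \<Rightarrow> real" where
  "curvature F l i = (\<Sum>(j, k) \<in> {(j, k). {i, j, k} \<in> F}. theta l i j k) / 2"

section \<open>Discrete conformal structures\<close>

definition coth :: "real \<Rightarrow> real" where
  "coth x = cosh x / sinh x"

definition has_partial :: "(real ^ 'n::finite \<Rightarrow> real) \<Rightarrow> real \<Rightarrow> 'n \<Rightarrow> real ^ 'n \<Rightarrow> bool" where
  "has_partial g D i f \<longleftrightarrow> ((\<lambda>t. g (f + t *\<^sub>R axis i 1)) has_real_derivative D) (at 0)"

text \<open>\<open>C^k\<close> regularity on an open set, by iterated directional derivatives.\<close>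

fun diff_on_order :: "nat \<Rightarrow> ('a::real_normed_vector) set \<Rightarrow> ('a \<Rightarrow> real) \<Rightarrow> bool" where
  "diff_on_order 0 S g \<longleftrightarrow> continuous_on S g"
| "diff_on_order (Suc k) S g \<longleftrightarrow>
     (\<forall>x\<in>S. g differentiable (at x)) \<and>
     (\<forall>v. diff_on_order k S (\<lambda>x. frechet_derivative g (at x) v))"

definition smooth_on :: "('a::real_normed_vector) set \<Rightarrow> ('a \<Rightarrow> real) \<Rightarrow> bool" where
  "smooth_on S g \<longleftrightarrow> (\<forall>k. diff_on_order k S g)"

definition edge_length :: "('n \<Rightarrow> 'n \<Rightarrow> real) \<Rightarrow> 'n \<Rightarrow> 'n \<Rightarrow> real" where
  "edge_length d i j = d i j + d j i"

text \<open>\<open>d f i j\<close> is the coordinate of \<open>d(f)\<close> at the oriented edge \<open>ij\<close>; values off the edges of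
  \<open>F\<close> and for \<open>f\<close> outside \<open>\<Omega>\<close> are irrelevant. The condition \<open>d f i j \<noteq> 0\<close> says that
  \<open>coth (d f i j)\<close> is defined, as division by zero is total in HOL.\<close>

definition discrete_conformal_structure ::
    "'n::finite set set \<Rightarrow> (real ^ 'n) set \<Rightarrow> (real ^ 'n \<Rightarrow> 'n \<Rightarrow> 'n \<Rightarrow> real) \<Rightarrow> bool" where
  "discrete_conformal_structure F \<Omega> d \<longleftrightarrow>
     (\<forall>i j. {i, j} \<in> edges F \<longrightarrow> smooth_on \<Omega> (\<lambda>f. d f i j)) \<and>
     (\<forall>f\<in>\<Omega>.
        (\<forall>i j. {i, j} \<in> edges F \<longrightarrow>
           edge_length (d f) i j > 0 \<and> d f i j \<noteq> 0 \<and>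
           has_partial (\<lambda>g. edge_length (d g) i j) (coth (d f i j)) i f \<and>
           (\<forall>k. k \<noteq> i \<longrightarrow> k \<noteq> j \<longrightarrow> has_partial (\<lambda>g. d g i j) 0 k f)) \<and>
        (\<forall>i j k. {i, j, k} \<in> F \<longrightarrow>
           sinh (d f i j) * sinh (d f j k) * sinh (d f k i) =
           sinh (d f j i) * sinh (d f k j) * sinh (d f i k)))"

section \<open>Mixed structures II\<close>

text \<open>\<open>EB\<close> is the set of edges of kind (B2); the other edges are of kind (A2). The weight
  \<open>\<eta>\<close> is a function of the unoriented edge.\<close>

definition mixed_ratio ::
    "'n set set \<Rightarrow> real ^ 'n::finite \<Rightarrow> 'n \<Rightarrow> 'n \<Rightarrow> real" where
  "mixed_ratio EB f i j =
     (if {i, j} \<in> EB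
      then - sqrt ((exp (2 * f $ i) - 1) / (exp (2 * f $ j) - 1))
      else sqrt ((exp (2 * f $ i) - 1) / (exp (2 * f $ j) - 1)))"

definition mixed_cosh ::
    "('n set \<Rightarrow> real) \<Rightarrow> 'n set set \<Rightarrow> real ^ 'n::finite \<Rightarrow> 'n \<Rightarrow> 'n \<Rightarrow> real" where
  "mixed_cosh \<eta> EB f i j =
     (if {i, j} \<in> EB
      then - sqrt ((exp (2 * f $ i) - 1) * (exp (2 * f $ j) - 1)) + \<eta> {i, j} * exp (f $ i + f $ j)
      else sqrt ((exp (2 * f $ i) - 1) * (exp (2 * f $ j) - 1)) + \<eta> {i, j} * exp (f $ i + f $ j))"

definition admissible_space ::
    "'n::finite set set \<Rightarrow> ('n set \<Rightarrow> real) \<Rightarrow> 'n set set \<Rightarrow> (real ^ 'n) set" where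
  "admissible_space F \<eta> EB =
     {f. (\<forall>i. f $ i > 0) \<and> (\<forall>i j. {i, j} \<in> edges F \<longrightarrow> mixed_cosh \<eta> EB f i j > 1)}"

text \<open>\<open>type_II EB \<Omega> d i j k\<close>: the hexagon \<open>ijk\<close> is Type-II with distinguished component \<open>i\<close>.\<close>

definition type_II ::
    "'n set set \<Rightarrow> (real ^ 'n::finite) set \<Rightarrow> (real ^ 'n \<Rightarrow> 'n \<Rightarrow> 'n \<Rightarrow> real) \<Rightarrow>
     'n \<Rightarrow> 'n \<Rightarrow> 'n \<Rightarrow> bool" where
  "type_II EB \<Omega> d i j k \<longleftrightarrow>
     {i, j} \<in> EB \<and> {i, k} \<in> EB \<and> {j, k} \<notin> EB \<and>
     (\<forall>f\<in>\<Omega>. d f i j < 0 \<and> d f i k < 0 \<and>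
        d f j i > 0 \<and> d f k i > 0 \<and> d f j k > 0 \<and> d f k j > 0)"

definition type_II_face ::
    "'n set set \<Rightarrow> (real ^ 'n::finite) set \<Rightarrow> (real ^ 'n \<Rightarrow> 'n \<Rightarrow> 'n \<Rightarrow> real) \<Rightarrow> 'n set \<Rightarrow> bool" where
  "type_II_face EB \<Omega> d t \<longleftrightarrow> (\<exists>i j k. t = {i, j, k} \<and> type_II EB \<Omega> d i j k)"

definition all_A2_face :: "'n set set \<Rightarrow> 'n set \<Rightarrow> bool" where
  "all_A2_face EB t \<longleftrightarrow> (\<forall>e. card e = 2 \<longrightarrow> e \<subseteq> t \<longrightarrow> e \<notin> EB)"

definition mixed_structure_II ::
    "'n::finite set set \<Rightarrow> ('n set \<Rightarrow> real) \<Rightarrow> 'n set set \<Rightarrow>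
     (real ^ 'n \<Rightarrow> 'n \<Rightarrow> 'n \<Rightarrow> real) \<Rightarrow> bool" where
  "mixed_structure_II F \<eta> EB d \<longleftrightarrow>
     EB \<subseteq> edges F \<and> EB \<noteq> {} \<and>
     discrete_conformal_structure F (admissible_space F \<eta> EB) d \<and>
     (\<forall>f\<in>admissible_space F \<eta> EB. \<forall>i j. {i, j} \<in> edges F \<longrightarrow>
        sinh (d f i j) / sinh (d f j i) = mixed_ratio EB f i j \<and>
        cosh (edge_length (d f) i j) = mixed_cosh \<eta> EB f i j) \<and>
     (\<forall>t\<in>F. all_A2_face EB t \<or> type_II_face EB (admissible_space F \<eta> EB) d t)"

end

theory Submission
  imports Defs
begin

text \<open>
  Put \<open>cos \<sigma>\<^sub>v = exp (- f\<^sub>v)\<close>, with \<open>\<sigma>\<^sub>v < 0\<close> exactly when \<open>v\<close> is the distinguished vertex of a Type-II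
  face. Then both edge formulas read \<open>cosh l\<^sub>i\<^sub>j = (sin \<sigma>\<^sub>i sin \<sigma>\<^sub>j + \<eta>\<^sub>i\<^sub>j) / (cos \<sigma>\<^sub>i cos \<sigma>\<^sub>j)\<close>, and
  \<open>cosh l\<^sub>i\<^sub>j > 1\<close> means \<open>cos (\<sigma>\<^sub>i + \<sigma>\<^sub>j) < \<eta>\<^sub>i\<^sub>j\<close>, so that \<open>\<Omega>\<close> is convex in \<open>\<sigma>\<close>. On each hexagon the Jacobian of \<open>\<theta>\<close> with respect to \<open>\<sigma>\<close> is symmetric and negative
  definite: its quadratic form is linear in the vector of the \<open>tan \<sigma>\<^sub>i\<close>, which lies in the cone
  \<open>tan \<sigma>\<^sub>i cosh l\<^sub>i\<^sub>j + tan \<sigma>\<^sub>j > 0\<close>, and it suffices to look at generators of this cone.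
  Along the segment between two points of \<open>\<Omega>\<close> the sum \<open>\<Sum>\<^sub>i \<Delta>\<sigma>\<^sub>i K\<^sub>i\<close> therefore decreases strictly.
\<close>

section \<open>Monotonicity of a single hexagon\<close>

lemma binary_form_pos:
  fixes a b u v :: real
  assumes "a > 0" "b > 0" "a * b > 1"
  shows "a * u\<^sup>2 - 2 * u * v + b * v\<^sup>2 \<ge> 0"
    and "a * u\<^sup>2 - 2 * u * v + b * v\<^sup>2 = 0 \<Longrightarrow> u = 0 \<and> v = 0"
proof -
  have *: "a * (a * u\<^sup>2 - 2 * u * v + b * v\<^sup>2) = (a * u - v)\<^sup>2 + (a * b - 1) * v\<^sup>2"
    by algebra
  have "a * (a * u\<^sup>2 - 2 * u * v + b * v\<^sup>2) \<ge> 0"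
    unfolding * using assms by simp
  then show "a * u\<^sup>2 - 2 * u * v + b * v\<^sup>2 \<ge> 0"
    using assms by (simp add: zero_le_mult_iff)
  assume "a * u\<^sup>2 - 2 * u * v + b * v\<^sup>2 = 0"
  then have "(a * u - v)\<^sup>2 + (a * b - 1) * v\<^sup>2 = 0"
    using * by simp
  then have "v = 0 \<and> (a * u - v)\<^sup>2 = 0"
    using assms by (smt (verit) mult_pos_pos zero_le_power2 zero_less_power2 mult_nonneg_nonneg)
  then show "u = 0 \<and> v = 0"
    using assms by auto
qed

text \<open>The coefficient of \<open>- tan \<sigma>\<^sub>1\<close> in the quadratic form of the Jacobian of the three sides \<open>\<theta>\<close>,
  up to a common positive factor; \<open>c1\<close> is \<open>cosh\<close> of the edge length opposite to vertex 1, and so on.\<close>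

definition corner_form :: "real \<Rightarrow> real \<Rightarrow> real \<Rightarrow> real \<Rightarrow> real \<Rightarrow> real \<Rightarrow> real" where
  "corner_form c1 c2 c3 x1 x2 x3 =
     (c1 + c2 * c3) / (c3\<^sup>2 - 1) * (x2 + c3 * x1)\<^sup>2
     - 2 * (x2 + c3 * x1) * (x3 + c2 * x1)
     + (c1 + c2 * c3) / (c2\<^sup>2 - 1) * (x3 + c2 * x1)\<^sup>2"

text \<open>The expression is minus the determinant of the symmetric matrix with diagonal entries 1
  and off-diagonal entries \<open>- c1\<close>, \<open>- c2\<close>, \<open>- c3\<close>.\<close>

lemma gram_pos:
  fixes c1 :: real
  assumes "c1 > 1" "c2 > 1" "c3 > 1"
  shows "c1\<^sup>2 + c2\<^sup>2 + c3\<^sup>2 + 2 * c1 * c2 * c3 - 1 > 0"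
proof -
  have "c1\<^sup>2 > 1" "c2\<^sup>2 \<ge> 0" "c3\<^sup>2 \<ge> 0" "2 * c1 * c2 * c3 > 0"
    using assms by simp_all
  then show ?thesis by linarith
qed

text \<open>In \<open>u = x2 + c3 * x1\<close> and \<open>v = x3 + c2 * x1\<close> this is a binary
  form, definite because \<open>(c1 + c2 * c3)^2\<close> exceeds
  \<open>(c2^2 - 1) * (c3^2 - 1)\<close> by exactly the quantity of \<open>gram_pos\<close>. In
  three variables it therefore has a kernel of dimension one.\<close>

lemma corner_form_nonneg:
  fixes c1 :: real
  assumes "c1 > 1" "c2 > 1" "c3 > 1"
  shows "corner_form c1 c2 c3 x1 x2 x3 \<ge> 0"
    and "corner_form c1 c2 c3 x1 x2 x3 = 0 \<Longrightarrow> x2 = - c3 * x1 \<and> x3 = - c2 * x1"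
proof -
  have S: "c2\<^sup>2 - 1 > 0" "c3\<^sup>2 - 1 > 0"
    using assms by simp_all
  have T: "c1 + c2 * c3 > 0"
    using assms by (simp add: add_pos_pos)
  have "(c1 + c2 * c3)\<^sup>2 - (c2\<^sup>2 - 1) * (c3\<^sup>2 - 1) = 2 * c1 * c2 * c3 + c1\<^sup>2 - 1 + c2\<^sup>2 + c3\<^sup>2"
    by algebra
  also have "\<dots> > 0"
    using gram_pos[OF assms] by simp
  finally have "(c1 + c2 * c3) / (c3\<^sup>2 - 1) * ((c1 + c2 * c3) / (c2\<^sup>2 - 1)) > 1"
    using S by (simp add: power2_eq_square mult.commute)
  note * = binary_form_pos[OF _ _ this, of "x2 + c3 * x1" "x3 + c2 * x1"]
  show "corner_form c1 c2 c3 x1 x2 x3 \<ge> 0"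
    unfolding corner_form_def using * S T by simp
  assume "corner_form c1 c2 c3 x1 x2 x3 = 0"
  then have "x2 + c3 * x1 = 0 \<and> x3 + c2 * x1 = 0"
    unfolding corner_form_def using * S T by simp
  then show "x2 = - c3 * x1 \<and> x3 = - c2 * x1" by simp
qed

text \<open>\<open>(-1, c3, c2)\<close> generates the extreme ray of the cone on which the first tangent is negative.\<close>

lemma corner_form_relation:
  fixes c1 :: real
  assumes "c1 > 1" "c2 > 1" "c3 > 1"
  shows "c3 * corner_form c2 c3 c1 x2 x3 x1 + c2 * corner_form c3 c1 c2 x3 x1 x2 - corner_form c1 c2 c3 x1 x2 x3
       = (c1\<^sup>2 + c2\<^sup>2 + c3\<^sup>2 + 2 * c1 * c2 * c3 - 1) / (c1\<^sup>2 - 1) * (c1 * (x2\<^sup>2 + x3\<^sup>2) + 2 * x2 * x3)"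
proof -
  have S: "c1\<^sup>2 - 1 > 0" "c2\<^sup>2 - 1 > 0" "c3\<^sup>2 - 1 > 0"
    using assms by simp_all
  \<comment> \<open>With the reciprocals as variables subject to \<open>I\<close>, the rational
    identity becomes a polynomial one.\<close>
  define i1 i2 i3 where i: "i1 = 1 / (c1\<^sup>2 - 1)" "i2 = 1 / (c2\<^sup>2 - 1)" "i3 = 1 / (c3\<^sup>2 - 1)"
  have I: "i1 * (c1\<^sup>2 - 1) = 1" "i2 * (c2\<^sup>2 - 1) = 1" "i3 * (c3\<^sup>2 - 1) = 1"
    using S by (simp_all add: i)
  have d: "a / (c1\<^sup>2 - 1) = a * i1" "a / (c2\<^sup>2 - 1) = a * i2" "a / (c3\<^sup>2 - 1) = a * i3" for a
    by (simp_all add: i)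
  show ?thesis
    unfolding corner_form_def d using I by algebra
qed

text \<open>With \<open>s1\<close>, \<open>s2\<close>, \<open>s3\<close> the tangents of the angles,
  \<open>c1'\<close>, \<open>c2'\<close>, \<open>c3'\<close> are the derivatives of the three edge
  values in direction \<open>x\<close>, and the left side is the derivative of the sum of
  \<open>x\<close>-weighted hexagon sides up to a common positive factor. The right side makes its
  linearity in the tangents visible.\<close>

lemma corner_form_sum:
  fixes c1 :: real
  assumes "c1 > 1" "c2 > 1" "c3 > 1"
    and "c1' = (s2 * c1 + s3) * x2 + (s3 * c1 + s2) * x3"
    and "c2' = (s3 * c2 + s1) * x3 + (s1 * c2 + s3) * x1"
    and "c3' = (s1 * c3 + s2) * x1 + (s2 * c3 + s1) * x2"
  shows "x1 * (c1' - (c2 + c1 * c3) * c3' / (c3\<^sup>2 - 1) - (c3 + c1 * c2) * c2' / (c2\<^sup>2 - 1))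
       + x2 * (c2' - (c3 + c2 * c1) * c1' / (c1\<^sup>2 - 1) - (c1 + c2 * c3) * c3' / (c3\<^sup>2 - 1))
       + x3 * (c3' - (c1 + c3 * c2) * c2' / (c2\<^sup>2 - 1) - (c2 + c3 * c1) * c1' / (c1\<^sup>2 - 1))
       = - (s1 * corner_form c1 c2 c3 x1 x2 x3 + s2 * corner_form c2 c3 c1 x2 x3 x1
            + s3 * corner_form c3 c1 c2 x3 x1 x2)"
proof -
  have S: "c1\<^sup>2 - 1 > 0" "c2\<^sup>2 - 1 > 0" "c3\<^sup>2 - 1 > 0"
    using assms by simp_all
  define i1 i2 i3 where i: "i1 = 1 / (c1\<^sup>2 - 1)" "i2 = 1 / (c2\<^sup>2 - 1)" "i3 = 1 / (c3\<^sup>2 - 1)"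
  have I: "i1 * (c1\<^sup>2 - 1) = 1" "i2 * (c2\<^sup>2 - 1) = 1" "i3 * (c3\<^sup>2 - 1) = 1"
    using S by (simp_all add: i)
  have d: "a / (c1\<^sup>2 - 1) = a * i1" "a / (c2\<^sup>2 - 1) = a * i2" "a / (c3\<^sup>2 - 1) = a * i3" for a
    by (simp_all add: i)
  show ?thesis
    unfolding corner_form_def d assms(4-6) using I by algebra
qed

text \<open>Both kernels are lines, and they meet only in the origin because
  \<open>c3^2 > 1\<close>.\<close>

lemma corner_forms_definite:
  fixes c1 :: real
  assumes "c1 > 1" "c2 > 1" "c3 > 1"
    and "corner_form c1 c2 c3 x1 x2 x3 = 0" "corner_form c2 c3 c1 x2 x3 x1 = 0"
  shows "x1 = 0 \<and> x2 = 0 \<and> x3 = 0"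
proof -
  have x: "x2 = - c3 * x1" "x3 = - c2 * x1" "x1 = - c3 * x2"
    using corner_form_nonneg(2) assms by blast+
  then have "(c3\<^sup>2 - 1) * x1 = 0"
    by algebra
  then have "x1 = 0"
    using assms(3) by (simp add: power2_eq_1_iff)
  then show ?thesis
    using x(1,2) by simp
qed

text \<open>Decompose the weights as \<open>(s1, s2, s3) = - s1 * (-1, c3, c2) + (0, s1 * c3 + s2,
  s1 * c2 + s3)\<close>. The extreme ray contributes a nonnegative amount by
  \<open>corner_form_relation\<close>; the rest is strictly positive since two corner forms never
  vanish together.\<close>

lemma corner_form_combination_pos_one_neg:
  fixes c1 :: real
  assumes c: "c1 > 1" "c2 > 1" "c3 > 1"
    and s: "s1 \<le> 0" "s1 * c3 + s2 > 0" "s1 * c2 + s3 > 0"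
    and x: "\<not> (x1 = 0 \<and> x2 = 0 \<and> x3 = 0)"
  shows "s1 * corner_form c1 c2 c3 x1 x2 x3 + s2 * corner_form c2 c3 c1 x2 x3 x1
       + s3 * corner_form c3 c1 c2 x3 x1 x2 > 0"
proof -
  let ?F1 = "corner_form c1 c2 c3 x1 x2 x3" and ?F2 = "corner_form c2 c3 c1 x2 x3 x1"
    and ?F3 = "corner_form c3 c1 c2 x3 x1 x2"
  have F: "?F2 \<ge> 0" "?F3 \<ge> 0"
    using c corner_form_nonneg by blast+
  have "\<not> (?F2 = 0 \<and> ?F3 = 0)"
    using corner_forms_definite[of c2 c3 c1 x2 x3 x1] c x by blast
  then have "(s1 * c3 + s2) * ?F2 + (s1 * c2 + s3) * ?F3 > 0"
    using F s by (smt (verit) mult_nonneg_nonneg mult_pos_pos)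
  moreover have "c3 * ?F2 + c2 * ?F3 - ?F1 \<ge> 0"
  proof -
    have "c1 * (x2\<^sup>2 + x3\<^sup>2) + 2 * x2 * x3 = (c1 - 1) * (x2\<^sup>2 + x3\<^sup>2) + (x2 + x3)\<^sup>2"
      by algebra
    also have "\<dots> \<ge> 0"
      using c by simp
    finally have "c1 * (x2\<^sup>2 + x3\<^sup>2) + 2 * x2 * x3 \<ge> 0" .
    then show ?thesis
      unfolding corner_form_relation[OF c] using gram_pos[OF c] c
      by (intro mult_nonneg_nonneg divide_nonneg_nonneg) auto
  qed
  then have "- s1 * (c3 * ?F2 + c2 * ?F3 - ?F1) \<ge> 0"
    using s by (intro mult_nonneg_nonneg) simp_all
  ultimately show ?thesis
    by (simp add: algebra_simps)
qed

text \<open>A nonpositive weight can be rotated into first position by cyclic symmetry; if all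
  weights are positive, definiteness of two of the forms suffices.\<close>

lemma corner_form_combination_pos:
  fixes c1 :: real
  assumes c: "c1 > 1" "c2 > 1" "c3 > 1"
    and s: "s1 * c3 + s2 > 0" "s2 * c3 + s1 > 0" "s1 * c2 + s3 > 0" "s3 * c2 + s1 > 0"
      "s2 * c1 + s3 > 0" "s3 * c1 + s2 > 0"
    and x: "\<not> (x1 = 0 \<and> x2 = 0 \<and> x3 = 0)"
  shows "s1 * corner_form c1 c2 c3 x1 x2 x3 + s2 * corner_form c2 c3 c1 x2 x3 x1
       + s3 * corner_form c3 c1 c2 x3 x1 x2 > 0"
proof -
  consider "s1 \<le> 0" | "s2 \<le> 0" | "s3 \<le> 0" | "s1 > 0" "s2 > 0" "s3 > 0"
    by linarith
  then show ?thesis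
  proof cases
    case 1
    show ?thesis
      using corner_form_combination_pos_one_neg[OF c 1 s(1,3) x] .
  next
    case 2
    show ?thesis
      using corner_form_combination_pos_one_neg[OF c(2,3,1) 2 s(5,2), of x2 x3 x1] x by linarith
  next
    case 3
    show ?thesis
      using corner_form_combination_pos_one_neg[OF c(3,1,2) 3 s(4,6), of x3 x1 x2] x by linarith
  next
    case 4
    have F: "corner_form c1 c2 c3 x1 x2 x3 \<ge> 0" "corner_form c2 c3 c1 x2 x3 x1 \<ge> 0"
      "corner_form c3 c1 c2 x3 x1 x2 \<ge> 0"
      using c corner_form_nonneg by blast+
    moreover have "\<not> (corner_form c1 c2 c3 x1 x2 x3 = 0 \<and> corner_form c2 c3 c1 x2 x3 x1 = 0)"
      using corner_forms_definite[OF c] x by blast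
    ultimately show ?thesis
      using 4 by (smt (verit) mult_nonneg_nonneg mult_pos_pos)
  qed
qed

section \<open>Variation of the hexagon sides along a segment of angles\<close>

definition hex_side :: "real \<Rightarrow> real \<Rightarrow> real \<Rightarrow> real" where
  "hex_side x y z = arcosh ((x + y * z) / (sqrt (y\<^sup>2 - 1) * sqrt (z\<^sup>2 - 1)))"

text \<open>The hyperbolic sine of the side is \<open>sqrt n / (Y * Z)\<close>, so
  \<open>Y * Z\<close> cancels in the chain rule. What remains is \<open>sqrt n\<close>, which is
  symmetric in the three edge values and hence a common denominator for all three sides.\<close>

lemma has_real_derivative_hex_side:
  assumes d: "(x has_real_derivative x') (at t)" "(y has_real_derivative y') (at t)"
      "(z has_real_derivative z') (at t)"
    and g: "x t > 1" "y t > 1" "z t > 1"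
  shows "((\<lambda>t. hex_side (x t) (y t) (z t)) has_real_derivative
     (x' - (z t + x t * y t) * y' / ((y t)\<^sup>2 - 1) - (y t + x t * z t) * z' / ((z t)\<^sup>2 - 1))
       / sqrt ((x t)\<^sup>2 + (y t)\<^sup>2 + (z t)\<^sup>2 + 2 * x t * y t * z t - 1)) (at t)"
proof -
  define Y Z n where Y: "Y = sqrt ((y t)\<^sup>2 - 1)" and Z: "Z = sqrt ((z t)\<^sup>2 - 1)"
    and n: "n = (x t)\<^sup>2 + (y t)\<^sup>2 + (z t)\<^sup>2 + 2 * x t * y t * z t - 1"
  have S: "(y t)\<^sup>2 - 1 > 0" "(z t)\<^sup>2 - 1 > 0"
    using g by simp_all
  then have YZ: "Y > 0" "Z > 0" "Y\<^sup>2 = (y t)\<^sup>2 - 1" "Z\<^sup>2 = (z t)\<^sup>2 - 1"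
    unfolding Y Z by simp_all
  have npos: "n > 0"
    unfolding n using gram_pos[OF g] .
  define X where X: "X = (x t + y t * z t) / (Y * Z)"
  have "X\<^sup>2 - 1 = ((x t + y t * z t)\<^sup>2 - Y\<^sup>2 * Z\<^sup>2) / (Y * Z)\<^sup>2"
    unfolding X using YZ(1,2) by (simp add: field_simps)
  also have "(x t + y t * z t)\<^sup>2 - Y\<^sup>2 * Z\<^sup>2 = n"
    unfolding YZ(3,4) n by algebra
  finally have X2: "X\<^sup>2 - 1 = n / (Y * Z)\<^sup>2" .
  then have sqX: "sqrt (X\<^sup>2 - 1) = sqrt n / (Y * Z)"
    using YZ by (simp add: real_sqrt_divide)
  have "X\<^sup>2 > 1"
    using X2 npos YZ by (smt (verit) divide_pos_pos mult_pos_pos zero_less_power)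
  moreover have "X \<ge> 0"
    unfolding X using g YZ by simp
  ultimately have X1: "X > 1"
    by (metis one_power2 power2_less_imp_less)
  have dY: "((\<lambda>t. sqrt ((y t)\<^sup>2 - 1)) has_real_derivative (y t * y' / Y)) (at t)"
    unfolding Y using S by (auto intro!: derivative_eq_intros d simp: field_simps)
  have dZ: "((\<lambda>t. sqrt ((z t)\<^sup>2 - 1)) has_real_derivative (z t * z' / Z)) (at t)"
    unfolding Z using S by (auto intro!: derivative_eq_intros d simp: field_simps)
  have dX: "((\<lambda>t. (x t + y t * z t) / (sqrt ((y t)\<^sup>2 - 1) * sqrt ((z t)\<^sup>2 - 1))) has_real_derivative
     (x' - (z t + x t * y t) * y' / Y\<^sup>2 - (y t + x t * z t) * z' / Z\<^sup>2) / (Y * Z)) (at t)"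
  proof -
    have "((\<lambda>t. (x t + y t * z t) / (sqrt ((y t)\<^sup>2 - 1) * sqrt ((z t)\<^sup>2 - 1))) has_real_derivative
      ((x' + (y' * z t + y t * z')) * (Y * Z) - (x t + y t * z t) * (y t * y' / Y * Z + Y * (z t * z' / Z)))
        / (Y * Z)\<^sup>2) (at t)"
      using DERIV_divide[OF DERIV_add[OF d(1) DERIV_mult[OF d(2,3)]] DERIV_mult[OF dY dZ]] YZ(1,2)
      unfolding Y[symmetric] Z[symmetric]
      by (simp add: power2_eq_square mult.commute add.commute)
    also have "((x' + (y' * z t + y t * z')) * (Y * Z) - (x t + y t * z t) * (y t * y' / Y * Z + Y * (z t * z' / Z)))
        / (Y * Z)\<^sup>2 = (x' + y' * (z t * Y\<^sup>2 - (x t + y t * z t) * y t) / Y\<^sup>2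
          + z' * (y t * Z\<^sup>2 - (x t + y t * z t) * z t) / Z\<^sup>2) / (Y * Z)"
      using YZ(1,2) by (simp add: field_simps power2_eq_square)
    also have "z t * Y\<^sup>2 - (x t + y t * z t) * y t = - (z t + x t * y t)"
      unfolding YZ by algebra
    also have "y t * Z\<^sup>2 - (x t + y t * z t) * z t = - (y t + x t * z t)"
      unfolding YZ by algebra
    finally show ?thesis
      unfolding mult_minus_right minus_divide_left[symmetric] add_uminus_conv_diff
      by (simp add: mult.commute)
  qed
  have "(arcosh has_real_derivative 1 / sqrt (X\<^sup>2 - 1)) (at X)"
    using X1 by (intro derivative_intros)
  then have "(arcosh has_real_derivative (Y * Z) / sqrt n) (at X)"
    unfolding sqX by simp
  from DERIV_chain2[OF this[unfolded X Y Z] dX] show ?thesis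
    unfolding hex_side_def Y[symmetric] Z[symmetric] n[symmetric] YZ(3,4)[symmetric]
    using YZ(1,2) by simp
qed

definition hex_cosh :: "real \<Rightarrow> real \<Rightarrow> real \<Rightarrow> real" where
  "hex_cosh h a b = (sin a * sin b + h) / (cos a * cos b)"

lemma has_real_derivative_hex_cosh:
  assumes d: "(a has_real_derivative a') (at t)" "(b has_real_derivative b') (at t)"
    and c: "cos (a t) > 0" "cos (b t) > 0"
  shows "((\<lambda>t. hex_cosh h (a t) (b t)) has_real_derivative
     (tan (a t) * hex_cosh h (a t) (b t) + tan (b t)) * a'
     + (tan (b t) * hex_cosh h (a t) (b t) + tan (a t)) * b') (at t)"
proof -
  have "sin (a t) ^ 2 = 1 - cos (a t) ^ 2" "sin (b t) ^ 2 = 1 - cos (b t) ^ 2"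
    by (simp_all add: sin_squared_eq)
  then show ?thesis
    unfolding hex_cosh_def tan_def using c
    apply (auto intro!: derivative_eq_intros d)
    apply (simp add: field_simps)
    done
qed

text \<open>The last two conditions say that both partial derivatives of \<open>hex_cosh\<close> are
  positive. Over the three edges of a hexagon they put the vector of tangents into the cone of
  \<open>corner_form_combination_pos\<close>.\<close>

definition regular_edge :: "real \<Rightarrow> real \<Rightarrow> real \<Rightarrow> bool" where
  "regular_edge h a b \<longleftrightarrow> cos a > 0 \<and> cos b > 0 \<and> hex_cosh h a b > 1 \<and>
     tan a * hex_cosh h a b + tan b > 0 \<and> tan b * hex_cosh h a b + tan a > 0"

text \<open>The derivative of \<open>H\<close> is minus the combination of corner forms weighted by
  the tangents, divided by \<open>sqrt n\<close>; it is negative because the tangents stay in the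
  cone throughout the segment.\<close>

lemma hexagon_monotone:
  fixes \<alpha>1 :: real
  assumes r: "\<And>t. 0 \<le> t \<Longrightarrow> t \<le> 1 \<Longrightarrow> regular_edge h1 (\<alpha>2 + t * x2) (\<alpha>3 + t * x3) \<and>
      regular_edge h2 (\<alpha>3 + t * x3) (\<alpha>1 + t * x1) \<and> regular_edge h3 (\<alpha>1 + t * x1) (\<alpha>2 + t * x2)"
    and x: "\<not> (x1 = 0 \<and> x2 = 0 \<and> x3 = 0)"
  defines "c1 \<equiv> \<lambda>t. hex_cosh h1 (\<alpha>2 + t * x2) (\<alpha>3 + t * x3)"
    and "c2 \<equiv> \<lambda>t. hex_cosh h2 (\<alpha>3 + t * x3) (\<alpha>1 + t * x1)"
    and "c3 \<equiv> \<lambda>t. hex_cosh h3 (\<alpha>1 + t * x1) (\<alpha>2 + t * x2)"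
  defines "H \<equiv> \<lambda>t. x1 * hex_side (c1 t) (c3 t) (c2 t) + x2 * hex_side (c2 t) (c1 t) (c3 t)
      + x3 * hex_side (c3 t) (c2 t) (c1 t)"
  shows "H 1 < H 0"
proof (rule DERIV_neg_imp_decreasing[where f = H and a = 0 and b = 1])
  fix t :: real
  assume t: "0 \<le> t" "t \<le> 1"
  define s1 s2 s3 where s: "s1 = tan (\<alpha>1 + t * x1)" "s2 = tan (\<alpha>2 + t * x2)" "s3 = tan (\<alpha>3 + t * x3)"
  have c: "c1 t > 1" "c2 t > 1" "c3 t > 1"
    and q: "s1 * c3 t + s2 > 0" "s2 * c3 t + s1 > 0" "s1 * c2 t + s3 > 0" "s3 * c2 t + s1 > 0"
      "s2 * c1 t + s3 > 0" "s3 * c1 t + s2 > 0"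
    and cs: "cos (\<alpha>1 + t * x1) > 0" "cos (\<alpha>2 + t * x2) > 0" "cos (\<alpha>3 + t * x3) > 0"
    using r[OF t] unfolding regular_edge_def c1_def c2_def c3_def s by auto
  have lin: "((\<lambda>t. \<alpha> + t * x) has_real_derivative x) (at t)" for \<alpha> x :: real
    by (auto intro!: derivative_eq_intros)
  define c1' c2' c3' where c': "c1' = (s2 * c1 t + s3) * x2 + (s3 * c1 t + s2) * x3"
    "c2' = (s3 * c2 t + s1) * x3 + (s1 * c2 t + s3) * x1"
    "c3' = (s1 * c3 t + s2) * x1 + (s2 * c3 t + s1) * x2"
  have dc: "(c1 has_real_derivative c1') (at t)" "(c2 has_real_derivative c2') (at t)"
    "(c3 has_real_derivative c3') (at t)"
    using has_real_derivative_hex_cosh[OF lin lin] cs unfolding c' s c1_def c2_def c3_def by blast+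
  define n where n: "n = (c1 t)\<^sup>2 + (c2 t)\<^sup>2 + (c3 t)\<^sup>2 + 2 * c1 t * c2 t * c3 t - 1"
  have npos: "n > 0"
    unfolding n using gram_pos[OF c] .
  have n': "(c1 t)\<^sup>2 + (c3 t)\<^sup>2 + (c2 t)\<^sup>2 + 2 * c1 t * c3 t * c2 t - 1 = n"
     "(c2 t)\<^sup>2 + (c1 t)\<^sup>2 + (c3 t)\<^sup>2 + 2 * c2 t * c1 t * c3 t - 1 = n"
     "(c3 t)\<^sup>2 + (c2 t)\<^sup>2 + (c1 t)\<^sup>2 + 2 * c3 t * c2 t * c1 t - 1 = n"
    unfolding n by algebra+
  let ?e1 = "c1' - (c2 t + c1 t * c3 t) * c3' / ((c3 t)\<^sup>2 - 1) - (c3 t + c1 t * c2 t) * c2' / ((c2 t)\<^sup>2 - 1)"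
  let ?e2 = "c2' - (c3 t + c2 t * c1 t) * c1' / ((c1 t)\<^sup>2 - 1) - (c1 t + c2 t * c3 t) * c3' / ((c3 t)\<^sup>2 - 1)"
  let ?e3 = "c3' - (c1 t + c3 t * c2 t) * c2' / ((c2 t)\<^sup>2 - 1) - (c2 t + c3 t * c1 t) * c1' / ((c1 t)\<^sup>2 - 1)"
  have "(H has_real_derivative x1 * (?e1 / sqrt n) + x2 * (?e2 / sqrt n) + x3 * (?e3 / sqrt n)) (at t)"
    unfolding H_def
    using has_real_derivative_hex_side[OF dc(1,3,2) c(1,3,2)]
      has_real_derivative_hex_side[OF dc(2,1,3) c(2,1,3)]
      has_real_derivative_hex_side[OF dc(3,2,1) c(3,2,1)]
    unfolding n' by (intro DERIV_add DERIV_cmult)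
  moreover have "x1 * (?e1 / sqrt n) + x2 * (?e2 / sqrt n) + x3 * (?e3 / sqrt n)
      = (x1 * ?e1 + x2 * ?e2 + x3 * ?e3) / sqrt n"
    by (simp add: add_divide_distrib)
  moreover have "x1 * ?e1 + x2 * ?e2 + x3 * ?e3 < 0"
    unfolding corner_form_sum[OF c c'] using corner_form_combination_pos[OF c q x] by simp
  ultimately show "\<exists>y. (H has_real_derivative y) (at t) \<and> y < 0"
    using npos by (auto intro!: divide_neg_pos)
qed simp

text \<open>Used with \<open>p = d f i j\<close>, \<open>r = d f j i\<close> and \<open>u\<close>,
  \<open>w\<close> the tangents. Expanding \<open>sinh r\<close> as
  \<open>sinh ((p + r) - p)\<close> gives
  \<open>u * cosh (p + r) + w = u / sinh p * sinh (p + r) * cosh p\<close>, where \<open>u\<close>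
  and \<open>p\<close> have the same sign.\<close>

lemma cosh_plus_ratio_pos:
  fixes p r u w :: real
  assumes "sinh p / sinh r = u / w" "r \<noteq> 0" "w \<noteq> 0" "p + r > 0" "p * u > 0"
  shows "u * cosh (p + r) + w > 0"
proof -
  have pu: "p \<noteq> 0" "u \<noteq> 0" "u / sinh p > 0"
    using assms(5) by (auto simp: zero_less_mult_iff zero_less_divide_iff)
  have "sinh r = sinh (p + r) * cosh p - cosh (p + r) * sinh p"
    using sinh_diff[of "p + r" p] by simp
  moreover have "w * sinh p = u * sinh r"
    using assms(1-3) by (simp add: field_simps)
  ultimately have "(u * cosh (p + r) + w) * sinh p = u * (sinh (p + r) * cosh p)"
    by algebra
  then have "u * cosh (p + r) + w = (u / sinh p) * (sinh (p + r) * cosh p)"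
    using pu by (simp add: field_simps)
  also have "\<dots> > 0"
    using pu(3) assms(4) by (intro mult_pos_pos) auto
  finally show ?thesis .
qed

lemma hex_cosh_gt_1_iff:
  assumes "cos a > 0" "cos b > 0"
  shows "hex_cosh h a b > 1 \<longleftrightarrow> cos (a + b) < h"
  using assms by (auto simp: hex_cosh_def cos_add)

text \<open>If the sum were nonpositive, so would be \<open>tan a + tan b\<close>, and each cone
  inequality would force its leading tangent to be positive, a contradiction. The bound keeps angle
  sums where the cosine is monotone.\<close>

lemma regular_edge_sum_pos:
  assumes "regular_edge h a b" "\<bar>a\<bar> < pi / 2" "\<bar>b\<bar> < pi / 2"
  shows "a + b > 0"
proof (rule ccontr)
  assume "\<not> a + b > 0"
  have c: "hex_cosh h a b > 1" and
    q: "tan a * hex_cosh h a b + tan b > 0" "tan b * hex_cosh h a b + tan a > 0"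
    using assms(1) by (auto simp: regular_edge_def)
  have "tan b \<le> tan (- a)"
    using \<open>\<not> a + b > 0\<close> assms by (subst tan_mono_le_eq) auto
  then have t: "tan b + tan a \<le> 0"
    by simp
  then have "tan a * (hex_cosh h a b - 1) > 0" "tan b * (hex_cosh h a b - 1) > 0"
    using q by (auto simp: algebra_simps)
  then show False
    using c t by (auto simp: zero_less_mult_iff)
qed

section \<open>Mixed structures in signed angles\<close>

definition signed_angle :: "'n set \<Rightarrow> real ^ 'n::finite \<Rightarrow> 'n \<Rightarrow> real" where
  "signed_angle D f v = (if v \<in> D then - arccos (exp (- f $ v)) else arccos (exp (- f $ v)))"

lemma arccos_exp_props:
  fixes x :: real
  assumes "x > 0"
  shows "0 < arccos (exp (- x))" "arccos (exp (- x)) < pi / 2" "cos (arccos (exp (- x))) = exp (- x)"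
    and "tan (arccos (exp (- x))) = sqrt (exp (2 * x) - 1)"
proof -
  have e: "exp (- x) < 1" "exp (- x) > 0"
    using assms by simp_all
  show c: "cos (arccos (exp (- x))) = exp (- x)"
    by (rule cos_arccos) (use e in linarith)+
  show "0 < arccos (exp (- x))"
    using arccos_less_arccos[of "exp (- x)" 1] e by simp
  show "arccos (exp (- x)) < pi / 2"
    using arccos_less_arccos[of 0 "exp (- x)"] e by simp
  have "sin (arccos (exp (- x))) = sqrt (1 - (exp (- x))\<^sup>2)"
    by (rule sin_arccos) (use e in linarith)+
  then have "tan (arccos (exp (- x))) = sqrt (1 - (exp (- x))\<^sup>2) / sqrt ((exp (- x))\<^sup>2)"
    unfolding tan_def c by simp
  also have "\<dots> = sqrt ((1 - (exp (- x))\<^sup>2) / (exp (- x))\<^sup>2)"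
    by (simp add: real_sqrt_divide)
  also have "(1 - (exp (- x))\<^sup>2) / (exp (- x))\<^sup>2 = exp (2 * x) - 1"
    by (simp add: exp_minus field_simps flip: exp_double)
  finally show "tan (arccos (exp (- x))) = sqrt (exp (2 * x) - 1)" .
qed

lemma signed_angle_props:
  assumes "f $ v > 0"
  shows "\<bar>signed_angle D f v\<bar> < pi / 2" "cos (signed_angle D f v) = exp (- f $ v)"
    and "tan (signed_angle D f v) = (if v \<in> D then - sqrt (exp (2 * f $ v) - 1) else sqrt (exp (2 * f $ v) - 1))"
    and "v \<in> D \<Longrightarrow> signed_angle D f v < 0" "v \<notin> D \<Longrightarrow> signed_angle D f v > 0"
  using arccos_exp_props[OF assms] by (auto simp: signed_angle_def)

text \<open>The product of the two tangents is the square root in the edge formula, with a minus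
  sign exactly when one of the ends lies in \<open>D\<close>.\<close>

lemma mixed_cosh_eq_hex_cosh:
  assumes "f $ i > 0" "f $ j > 0" "{i, j} \<in> EB \<longleftrightarrow> (i \<in> D) \<noteq> (j \<in> D)"
  shows "mixed_cosh \<eta> EB f i j = hex_cosh (\<eta> {i, j}) (signed_angle D f i) (signed_angle D f j)"
proof -
  have "hex_cosh h a b = tan a * tan b + h / (cos a * cos b)" for h a b
    by (simp add: hex_cosh_def tan_def add_divide_distrib)
  then show ?thesis
    using assms(3) unfolding mixed_cosh_def
    by (auto simp: signed_angle_props assms(1,2) real_sqrt_mult exp_minus exp_add divide_inverse)
qed

lemma mixed_ratio_eq_tan:
  assumes "f $ i > 0" "f $ j > 0" "{i, j} \<in> EB \<longleftrightarrow> (i \<in> D) \<noteq> (j \<in> D)"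
  shows "mixed_ratio EB f i j = tan (signed_angle D f i) / tan (signed_angle D f j)"
  using assms(3) unfolding mixed_ratio_def
  by (auto simp: signed_angle_props assms(1,2) real_sqrt_divide)

section \<open>Combinatorics of the distinguished vertices\<close>

lemma type_II_commute: "type_II EB \<Omega> d i j k \<longleftrightarrow> type_II EB \<Omega> d i k j"
  by (auto simp: type_II_def insert_commute)

definition type_II_vertices ::
    "'n set set \<Rightarrow> 'n set set \<Rightarrow> (real ^ 'n::finite) set \<Rightarrow> (real ^ 'n \<Rightarrow> 'n \<Rightarrow> 'n \<Rightarrow> real) \<Rightarrow> 'n set" where
  "type_II_vertices F EB \<Omega> d = {v. \<exists>a b. {v, a, b} \<in> F \<and> type_II EB \<Omega> d v a b}"

lemma face_edges:
  assumes "closed_surface_triangulation F" "{i, j, k} \<in> F"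
  shows "i \<noteq> j" "j \<noteq> k" "i \<noteq> k" "{i, j} \<in> edges F" "{j, i} \<in> edges F" "{j, k} \<in> edges F" "{k, j} \<in> edges F"
    "{i, k} \<in> edges F" "{k, i} \<in> edges F"
proof -
  have "card {i, j, k} = 3"
    using assms by (auto simp: closed_surface_triangulation_def)
  then show ne: "i \<noteq> j" "j \<noteq> k" "i \<noteq> k"
    by (auto simp: card_insert_if split: if_splits)
  show "{i, j} \<in> edges F" "{j, i} \<in> edges F" "{j, k} \<in> edges F" "{k, j} \<in> edges F"
    "{i, k} \<in> edges F" "{k, i} \<in> edges F"
    using ne assms(2) by (auto simp: edges_def intro!: bexI[of _ "{i, j, k}"])
qed

lemma edge_in_face:
  assumes "closed_surface_triangulation F" "{v, a} \<in> edges F"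
  obtains b where "{v, a, b} \<in> F" "v \<noteq> a"
proof -
  obtain t where t: "t \<in> F" "{v, a} \<subseteq> t" and c: "card {v, a} = 2"
    using assms(2) by (auto simp: edges_def)
  have "card t = 3"
    using assms(1) t by (auto simp: closed_surface_triangulation_def)
  then have "card (t - {v, a}) = 1"
    using t c by (subst card_Diff_subset) auto
  then obtain b where "t - {v, a} = {b}"
    by (auto simp: card_1_singleton_iff)
  then have "t = {v, a, b}"
    using t by auto
  moreover have "v \<noteq> a"
    using c by auto
  ultimately show thesis
    using t that by blast
qed

context
  fixes F EB :: "'n::finite set set" and \<eta> :: "'n set \<Rightarrow> real"
    and d :: "real ^ 'n \<Rightarrow> 'n \<Rightarrow> 'n \<Rightarrow> real"
  assumes tri: "closed_surface_triangulation F"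
    and mixed: "mixed_structure_II F \<eta> EB d"
begin

abbreviation (input) "\<Omega>' \<equiv> admissible_space F \<eta> EB"
abbreviation (input) "D \<equiv> type_II_vertices F EB \<Omega>' d"

text \<open>A face with a (B2) edge must be Type-II, and its distinguished vertex lies on that edge
  because the edge opposite to it is of kind (A2).\<close>

lemma type_II_cases:
  assumes "{v, a, b} \<in> F" "{v, a} \<in> EB"
  obtains "type_II EB \<Omega>' d v a b" | "type_II EB \<Omega>' d a v b"
proof -
  note ne = face_edges(1-3)[OF tri assms(1)]
  have "\<not> all_A2_face EB {v, a, b}"
    using assms(2) ne by (auto simp: all_A2_face_def intro!: exI[of _ "{v, a}"])
  then obtain i j k where eq: "{v, a, b} = {i, j, k}" and II: "type_II EB \<Omega>' d i j k"
    using mixed assms(1) unfolding mixed_structure_II_def type_II_face_def by blast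
  have jk: "{j, k} \<notin> EB"
    using II by (simp add: type_II_def)
  have "i = v \<or> i = a \<or> i = b"
    using eq by blast
  then consider "i = v" | "i = a" | "i = b"
    by blast
  then show thesis
  proof cases
    case 1
    have "{a, b} = {j, k}"
      using eq 1 ne face_edges(1-3)[OF tri assms(1)[unfolded eq]] by (auto simp: set_eq_iff)
    then have "j = a \<and> k = b \<or> j = b \<and> k = a"
      by (auto simp: doubleton_eq_iff)
    then show thesis
      using II 1 that(1) type_II_commute by blast
  next
    case 2
    have "{v, b} = {j, k}"
      using eq 2 ne face_edges(1-3)[OF tri assms(1)[unfolded eq]] by (auto simp: set_eq_iff)
    then have "j = v \<and> k = b \<or> j = b \<and> k = v"
      by (auto simp: doubleton_eq_iff)
    then show thesis
      using II 2 that(2) type_II_commute by blast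
  next
    case 3
    have "{v, a} = {j, k}"
      using eq 3 ne face_edges(1-3)[OF tri assms(1)[unfolded eq]] by (auto simp: set_eq_iff)
    then show thesis
      using jk assms(2) by simp
  qed
qed

text \<open>Links are connected, so the distinguished vertex of one Type-II face is distinguished in all
  faces around it; this makes the sign of \<open>signed_angle\<close> well defined.\<close>

lemma edges_at_type_II_vertex:
  assumes f: "f \<in> \<Omega>'" and v: "v \<in> D" and e: "{v, a} \<in> edges F"
  shows "{v, a} \<in> EB \<and> d f v a < 0"
proof -
  obtain a0 b0 where 0: "{v, a0, b0} \<in> F" "type_II EB \<Omega>' d v a0 b0"
    using v by (auto simp: type_II_vertices_def)
  have "(a0, a) \<in> {(x, y). {v, x, y} \<in> F}\<^sup>*"
    using tri face_edges[OF tri 0(1)] e by (auto simp: closed_surface_triangulation_def)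
  then show ?thesis
  proof (induction rule: rtrancl_induct)
    case base
    then show ?case
      using 0(2) f by (auto simp: type_II_def)
  next
    case (step x y)
    \<comment> \<open>Walk around the link across the face \<open>{v, x, y}\<close>: its
      distinguished vertex is \<open>v\<close> or \<open>x\<close>, and \<open>d f v x < 0\<close>
      excludes \<open>x\<close>, so \<open>{v, y}\<close> inherits the claim.\<close>
    from step(2) have "{v, x, y} \<in> F"
      by simp
    from this step(3)[THEN conjunct1] show ?case
    proof (cases rule: type_II_cases)
      case 1
      then show ?thesis
        using f by (simp add: type_II_def)
    next
      case 2
      then have "d f v x > 0"
        using f by (simp add: type_II_def)
      with step(3) show ?thesis
        by simp
    qed
  qed
qed

text \<open>The signs of \<open>d\<close> at the two ends of a (B2) edge are opposite, so
  \<open>edges_at_type_II_vertex\<close> leaves only one end for \<open>D\<close>; an (A2) edge has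
  none, as every edge at a vertex of \<open>D\<close> is of kind (B2).\<close>

lemma mixed_edge_cases:
  assumes f: "f \<in> \<Omega>'" and e: "{v, a} \<in> edges F"
  obtains "{v, a} \<in> EB" "v \<in> D" "a \<notin> D" "d f v a < 0" "d f a v > 0"
  | "{v, a} \<in> EB" "v \<notin> D" "a \<in> D" "d f v a > 0" "d f a v < 0"
  | "{v, a} \<notin> EB" "v \<notin> D" "a \<notin> D"
proof -
  obtain b where b: "{v, a, b} \<in> F"
    using edge_in_face[OF tri e] by blast
  have b': "{a, v, b} \<in> F" and e': "{a, v} \<in> edges F"
    using b e by (simp_all add: insert_commute)
  show thesis
  proof (cases "{v, a} \<in> EB")
    case True
    from b True show ?thesis
    proof (cases rule: type_II_cases)
      case 1
      then have "v \<in> D" "d f v a < 0" "d f a v > 0"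
        using b f by (auto simp: type_II_vertices_def type_II_def)
      then show ?thesis
        using edges_at_type_II_vertex[OF f _ e'] that(1) True by fastforce
    next
      case 2
      then have "a \<in> D" "d f a v < 0" "d f v a > 0"
        using b' f by (auto simp: type_II_vertices_def type_II_def)
      then show ?thesis
        using edges_at_type_II_vertex[OF f _ e] that(2) True by fastforce
    qed
  next
    case False
    then show ?thesis
      using edges_at_type_II_vertex[OF f _ e] edges_at_type_II_vertex[OF f _ e'] that(3)
      by (auto simp: insert_commute)
  qed
qed

lemma mem_EB_iff:
  assumes "f \<in> \<Omega>'" "{i, j} \<in> edges F"
  shows "{i, j} \<in> EB \<longleftrightarrow> (i \<in> D) \<noteq> (j \<in> D)"
  using assms by (cases rule: mixed_edge_cases) auto

section \<open>Edge inequalities and convexity of the admissible space in signed angles\<close>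

lemma cosh_edge_length:
  assumes f: "f \<in> \<Omega>'" and e: "{i, j} \<in> edges F"
  shows "cosh (edge_length (d f) i j) = hex_cosh (\<eta> {i, j}) (signed_angle D f i) (signed_angle D f j)"
    and "edge_length (d f) i j > 0"
proof -
  have "f $ i > 0" "f $ j > 0"
    using f by (auto simp: admissible_space_def)
  note mc = mixed_cosh_eq_hex_cosh[OF this mem_EB_iff[OF f e]]
  show "cosh (edge_length (d f) i j) = hex_cosh (\<eta> {i, j}) (signed_angle D f i) (signed_angle D f j)"
    using mixed f e mc unfolding mixed_structure_II_def by metis
  show "edge_length (d f) i j > 0"
    using mixed f e unfolding mixed_structure_II_def discrete_conformal_structure_def by blast
qed

text \<open>On (B2) edges the signs of \<open>d f i j\<close> and of the tangent at \<open>i\<close>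
  agree, so \<open>cosh_plus_ratio_pos\<close> applies; on (A2) edges both tangents are
  positive.\<close>

lemma tan_combination_pos:
  assumes f: "f \<in> \<Omega>'" and e: "{i, j} \<in> edges F"
  shows "tan (signed_angle D f i) * cosh (edge_length (d f) i j) + tan (signed_angle D f j) > 0"
proof -
  have fp: "f $ i > 0" "f $ j > 0"
    using f by (auto simp: admissible_space_def)
  have r: "sinh (d f i j) / sinh (d f j i) = tan (signed_angle D f i) / tan (signed_angle D f j)"
    using mixed f e mixed_ratio_eq_tan[OF fp mem_EB_iff[OF f e]]
    unfolding mixed_structure_II_def by metis
  have pos: "d f i j + d f j i > 0"
    using cosh_edge_length(2)[OF f e] by (simp add: edge_length_def)
  have t: "sqrt (exp (2 * f $ i) - 1) > 0" "sqrt (exp (2 * f $ j) - 1) > 0"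
    using fp by simp_all
  from f e show ?thesis
  proof (cases rule: mixed_edge_cases)
    case 1
    then show ?thesis
      unfolding edge_length_def using t fp
      by (intro cosh_plus_ratio_pos[OF r _ _ pos]) (auto simp: signed_angle_props mult_less_0_iff)
  next
    case 2
    then show ?thesis
      unfolding edge_length_def using t fp
      by (intro cosh_plus_ratio_pos[OF r _ _ pos]) (auto simp: signed_angle_props)
  next
    case 3
    then show ?thesis
      using t by (auto simp: signed_angle_props fp intro!: add_pos_pos mult_pos_pos)
  qed
qed

lemma regular_edge_signed_angle:
  assumes f: "f \<in> \<Omega>'" and e: "{i, j} \<in> edges F"
  shows "regular_edge (\<eta> {i, j}) (signed_angle D f i) (signed_angle D f j)"
proof -
  have fp: "f $ i > 0" "f $ j > 0"
    using f by (auto simp: admissible_space_def)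
  have "{j, i} \<in> edges F"
    using e by (simp add: insert_commute)
  from tan_combination_pos[OF f this] tan_combination_pos[OF f e] show ?thesis
    using cosh_real_strict_mono[OF order.refl cosh_edge_length(2)[OF f e]]
    by (auto simp: regular_edge_def cosh_edge_length(1)[OF f e, symmetric] signed_angle_props(2) fp
        edge_length_def add.commute)
qed

text \<open>On each edge the angle sum stays between its end values, which lie in
  \<open>(0, pi)\<close>. The cosine decreases there, so it stays at most its value at the smaller
  end sum, which is below \<eta>.\<close>

lemma segment_in_admissible_space:
  assumes f: "f \<in> \<Omega>'" and g: "g \<in> \<Omega>'" and t: "0 \<le> t" "t \<le> 1"
  obtains h where "h \<in> \<Omega>'"
    "\<And>v. signed_angle D h v = signed_angle D f v + t * (signed_angle D g v - signed_angle D f v)"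
proof -
  define \<sigma> where "\<sigma> v = signed_angle D f v + t * (signed_angle D g v - signed_angle D f v)" for v
  define h :: "real ^ 'n" where "h = (\<chi> v. - ln (cos (\<sigma> v)))"
  have fg: "f $ v > 0" "g $ v > 0" for v
    using f g by (auto simp: admissible_space_def)
  have conv: "m < a \<Longrightarrow> m < b \<Longrightarrow> m < a + t * (b - a)" "a < m \<Longrightarrow> b < m \<Longrightarrow> a + t * (b - a) < m"
    for a b m :: real
    using convex_bound_lt[of a m b "1 - t" t] convex_bound_lt[of "-a" "-m" "-b" "1 - t" t] t
    by (simp_all add: algebra_simps)
  have s1: "\<bar>\<sigma> v\<bar> < pi / 2" for v
  proof -
    have "- (pi / 2) < \<sigma> v" "\<sigma> v < pi / 2"
      unfolding \<sigma>_def
      using signed_angle_props(1)[OF fg(1), of D v] signed_angle_props(1)[OF fg(2), of D v]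
      by (intro conv; linarith)+
    then show ?thesis
      by linarith
  qed
  \<comment> \<open>Signs persist along the segment, so \<open>h\<close> has the same set of
    negative angles and \<open>\<sigma>\<close> really is its signed angle.\<close>
  have s2: "v \<in> D \<Longrightarrow> \<sigma> v < 0" "v \<notin> D \<Longrightarrow> \<sigma> v > 0" for v
    unfolding \<sigma>_def using signed_angle_props(4,5)[OF fg(1)] signed_angle_props(4,5)[OF fg(2)]
    by (auto intro!: conv)
  have cpos: "cos (\<sigma> v) > 0" for v
    using s1[of v] by (intro cos_gt_zero_pi) auto
  have clt: "cos (\<sigma> v) < 1" for v
  proof -
    have "0 < \<bar>\<sigma> v\<bar>"
      using s2[of v] by (cases "v \<in> D") auto
    then have "cos \<bar>\<sigma> v\<bar> < cos 0"
      using s1[of v] by (intro cos_monotone_0_pi) auto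
    then show ?thesis
      by (simp add: abs_if split: if_splits)
  qed
  have hpos: "h $ v > 0" for v
    using cpos[of v] clt[of v] by (simp add: h_def)
  have sh: "signed_angle D h v = \<sigma> v" for v
    using s1[of v] s2[of v] cpos[of v]
    by (auto simp: signed_angle_def h_def arccos_cos arccos_cos2)
  have "mixed_cosh \<eta> EB h i j > 1" if e: "{i, j} \<in> edges F" for i j
  proof -
    have reg: "regular_edge (\<eta> {i, j}) (signed_angle D f i) (signed_angle D f j)"
      "regular_edge (\<eta> {i, j}) (signed_angle D g i) (signed_angle D g j)"
      using regular_edge_signed_angle e f g by blast+
    let ?a = "signed_angle D f i + signed_angle D f j" and ?b = "signed_angle D g i + signed_angle D g j"
    have "?a > 0" "?b > 0"
      using reg by (auto intro!: regular_edge_sum_pos signed_angle_props(1) fg)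
    moreover have "?a < pi" "?b < pi"
      using signed_angle_props(1)[OF fg(1), of D] signed_angle_props(1)[OF fg(2), of D]
      by (smt (verit) field_sum_of_halves)+
    moreover have ab: "cos ?a < \<eta> {i, j}" "cos ?b < \<eta> {i, j}"
      using reg by (auto simp: regular_edge_def hex_cosh_gt_1_iff)
    moreover have sm: "\<sigma> i + \<sigma> j = ?a + t * (?b - ?a)"
      by (simp add: \<sigma>_def algebra_simps)
    moreover have "min ?a ?b \<le> ?a + t * (?b - ?a)"
      using convex_bound_le[of "-?a" "- min ?a ?b" "-?b" "1 - t" t] t by (simp add: algebra_simps)
    moreover have "\<sigma> i + \<sigma> j \<le> pi"
      using s1[of i] s1[of j] by linarith
    ultimately have "cos (\<sigma> i + \<sigma> j) \<le> cos (min ?a ?b)"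
      by (intro cos_monotone_0_pi_le) auto
    also have "\<dots> < \<eta> {i, j}"
      using ab by (simp add: min_def)
    finally have "hex_cosh (\<eta> {i, j}) (\<sigma> i) (\<sigma> j) > 1"
      using hex_cosh_gt_1_iff cpos by blast
    then show ?thesis
      using mixed_cosh_eq_hex_cosh[OF hpos hpos mem_EB_iff[OF f e]] sh by simp
  qed
  then have "h \<in> \<Omega>'"
    using hpos by (simp add: admissible_space_def)
  then show thesis
    using that sh unfolding \<sigma>_def by blast
qed

section \<open>Comparison of two conformal factors on each face and on the whole surface\<close>

lemma theta_eq_hex_side:
  assumes f: "f \<in> \<Omega>'" and t: "{i, j, k} \<in> F"
  shows "theta (edge_length (d f)) i j k = hex_side (cosh (edge_length (d f) j k))
    (cosh (edge_length (d f) i j)) (cosh (edge_length (d f) i k))"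
proof -
  have "sqrt ((cosh x)\<^sup>2 - 1) = sinh x" if "x > 0" for x :: real
    using that by (simp add: cosh_square_eq)
  then show ?thesis
    using cosh_edge_length(2)[OF f] face_edges[OF tri t]
    by (simp add: theta_def hex_side_def)
qed

text \<open>\<open>hexagon_monotone\<close> needs regular edges at all intermediate angles; these
  hold because every such point is realised by some \<open>h\<close> in \<Omega>.\<close>

lemma face_monotone:
  assumes f: "f \<in> \<Omega>'" and g: "g \<in> \<Omega>'" and face: "{i, j, k} \<in> F"
  defines "x \<equiv> \<lambda>v. signed_angle D g v - signed_angle D f v"
  defines "S \<equiv> \<lambda>h. x i * theta (edge_length (d h)) i j k + x j * theta (edge_length (d h)) j k i
      + x k * theta (edge_length (d h)) k i j"
  assumes ne: "\<not> (x i = 0 \<and> x j = 0 \<and> x k = 0)"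
  shows "S g < S f"
proof -
  note E = face_edges[OF tri face]
  have faces: "{j, k, i} \<in> F" "{k, i, j} \<in> F"
    using face by (simp_all add: insert_commute)
  let ?\<sigma> = "\<lambda>t v. signed_angle D f v + t * x v"
  let ?C = "\<lambda>t u v. hex_cosh (\<eta> {u, v}) (?\<sigma> t u) (?\<sigma> t v)"
  have reg: "regular_edge (\<eta> {u, v}) (?\<sigma> t u) (?\<sigma> t v)"
    if t: "0 \<le> t" "t \<le> 1" and e: "{u, v} \<in> edges F" for t u v
  proof -
    obtain h where h: "h \<in> \<Omega>'" and "\<And>v. signed_angle D h v = ?\<sigma> t v"
      using segment_in_admissible_space[OF f g t] unfolding x_def by blast
    then show ?thesis
      using regular_edge_signed_angle[OF h e] by simp
  qed
  \<comment> \<open>\<open>theta\<close> names both edges from its own vertex, whereas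
    \<open>hexagon_monotone\<close> runs around the face cyclically.\<close>
  have sym: "?C t u v = ?C t v u" for t u v
    by (simp add: hex_cosh_def insert_commute mult.commute)
  have S: "S h = x i * hex_side (?C t j k) (?C t i j) (?C t k i)
      + x j * hex_side (?C t k i) (?C t j k) (?C t i j)
      + x k * hex_side (?C t i j) (?C t k i) (?C t j k)"
    if h: "h \<in> \<Omega>'" and eq: "\<And>v. ?\<sigma> t v = signed_angle D h v" for h t
  proof -
    have "cosh (edge_length (d h) u v) = ?C t u v" if "{u, v} \<in> edges F" for u v
      using cosh_edge_length(1)[OF h that] eq by simp
    then show ?thesis
      unfolding S_def theta_eq_hex_side[OF h face] theta_eq_hex_side[OF h faces(1)]
        theta_eq_hex_side[OF h faces(2)]
      by (simp only: E sym[of i k t] sym[of j i t] sym[of k j t])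
  qed
  have "S g = x i * hex_side (?C 1 j k) (?C 1 i j) (?C 1 k i)
      + x j * hex_side (?C 1 k i) (?C 1 j k) (?C 1 i j)
      + x k * hex_side (?C 1 i j) (?C 1 k i) (?C 1 j k)"
    by (rule S[OF g]) (simp add: x_def)
  also have "\<dots> < x i * hex_side (?C 0 j k) (?C 0 i j) (?C 0 k i)
      + x j * hex_side (?C 0 k i) (?C 0 j k) (?C 0 i j)
      + x k * hex_side (?C 0 i j) (?C 0 k i) (?C 0 j k)"
    by (rule hexagon_monotone) (use reg E ne in auto)
  also have "\<dots> = S f"
    by (rule S[OF f, symmetric]) simp
  finally show ?thesis .
qed

end

text \<open>Rotating the ordered triples shows that the three summands have equal totals, and each
  total is twice the weighted curvature because of the factor 1/2 in \<open>curvature\<close>; hence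
  \<open>6 = 3 * 2\<close>.\<close>

lemma sum_curvature:
  fixes F :: "'n::finite set set" and x :: "'n \<Rightarrow> real"
  shows "6 * (\<Sum>i\<in>UNIV. x i * curvature F l i) = (\<Sum>(i, j, k)\<in>{(i, j, k). {i, j, k} \<in> F}.
     x i * theta l i j k + x j * theta l j k i + x k * theta l k i j)"
proof -
  let ?T = "{(i, j, k). {i, j, k} \<in> F}"
  let ?S = "\<Sum>(i, j, k)\<in>?T. x i * theta l i j k"
  have rot: "bij_betw (\<lambda>(i, j, k). (j, k, i)) ?T ?T"
    by (rule bij_betw_byWitness[where f' = "\<lambda>(i, j, k). (k, i, j)"]) (auto simp: insert_commute)
  have rot': "bij_betw (\<lambda>(i, j, k). (k, i, j)) ?T ?T"
    by (rule bij_betw_byWitness[where f' = "\<lambda>(i, j, k). (j, k, i)"]) (auto simp: insert_commute)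
  have 1: "(\<Sum>(i, j, k)\<in>?T. x j * theta l j k i) = ?S"
    using sum.reindex_bij_betw[OF rot, of "\<lambda>(i, j, k). x i * theta l i j k"]
    by (simp add: case_prod_unfold)
  have 2: "(\<Sum>(i, j, k)\<in>?T. x k * theta l k i j) = ?S"
    using sum.reindex_bij_betw[OF rot', of "\<lambda>(i, j, k). x i * theta l i j k"]
    by (simp add: case_prod_unfold)
  have "?T = (SIGMA i:UNIV. {(j, k). {i, j, k} \<in> F})"
    by auto
  then have "?S = (\<Sum>i\<in>UNIV. \<Sum>(j, k)\<in>{(j, k). {i, j, k} \<in> F}. x i * theta l i j k)"
    by (simp add: sum.Sigma case_prod_unfold)
  also have "\<dots> = (\<Sum>i\<in>UNIV. 2 * (x i * curvature F l i))"
    by (simp add: curvature_def case_prod_unfold flip: sum_distrib_left)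
  also have "\<dots> = 2 * (\<Sum>i\<in>UNIV. x i * curvature F l i)"
    by (simp add: sum_distrib_left)
  finally show ?thesis
    using 1 2 by (simp add: case_prod_unfold sum.distrib)
qed

theorem theorem7p5:
  fixes F :: "'n::finite set set"
    and \<eta> :: "'n set \<Rightarrow> real"
    and EB :: "'n set set"
    and d :: "real ^ 'n \<Rightarrow> 'n \<Rightarrow> 'n \<Rightarrow> real"
  defines "\<Omega> \<equiv> admissible_space F \<eta> EB"
  assumes "closed_surface_triangulation F"
    and "mixed_structure_II F \<eta> EB d"
    and "((\<forall>t\<in>F. type_II_face EB \<Omega> d t) \<and>
          (\<forall>i j k. {i, j, k} \<in> F \<longrightarrow> type_II EB \<Omega> d i j k \<longrightarrow>
             \<eta> {i, j} \<ge> 0 \<and> \<eta> {i, k} \<ge> 0 \<and> \<eta> {j, k} > -1))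
       \<or> (\<not> (\<forall>t\<in>F. type_II_face EB \<Omega> d t) \<and>
          (\<forall>i j k. {i, j, k} \<in> F \<longrightarrow> type_II EB \<Omega> d i j k \<longrightarrow>
             \<eta> {i, j} \<ge> 0 \<and> \<eta> {i, k} \<ge> 0 \<and> \<eta> {j, k} > -1) \<and>
          (\<forall>t\<in>F. all_A2_face EB t \<longrightarrow> (\<forall>e\<in>edges F. e \<subseteq> t \<longrightarrow> \<eta> e > -1)))"
  shows "inj_on (\<lambda>f. \<chi> i. curvature F (edge_length (d f)) i) \<Omega>"
proof (rule inj_onI, rule ccontr)
  fix f g
  assume f: "f \<in> \<Omega>" and g: "g \<in> \<Omega>" and "f \<noteq> g"
    and eq: "(\<chi> i. curvature F (edge_length (d f)) i) = (\<chi> i. curvature F (edge_length (d g)) i)"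
  let ?D = "type_II_vertices F EB \<Omega> d"
  define x where "x v = signed_angle ?D g v - signed_angle ?D f v" for v
  define S where "S h = (\<lambda>(i, j, k). x i * theta (edge_length (d h)) i j k
    + x j * theta (edge_length (d h)) j k i + x k * theta (edge_length (d h)) k i j)" for h
  let ?T = "{(i, j, k). {i, j, k} \<in> F}"
  obtain v where v: "f $ v \<noteq> g $ v"
    using \<open>f \<noteq> g\<close> by (auto simp: vec_eq_iff)
  have "f $ v > 0" "g $ v > 0"
    using f g by (auto simp: \<Omega>_def admissible_space_def)
  \<comment> \<open>The cosine of the signed angle is \<open>exp (- f $ v)\<close>, so equal angles
    would give equal factors.\<close>
  then have xv: "x v \<noteq> 0"
    using v signed_angle_props(2)[of f v ?D] signed_angle_props(2)[of g v ?D] by (auto simp: x_def)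
  have "v \<in> \<Union>F" and card3: "\<forall>t\<in>F. card t = 3"
    using assms(2) unfolding closed_surface_triangulation_def by simp_all
  then obtain t where t: "t \<in> F" "v \<in> t"
    by blast
  then have "card (t - {v}) = 2"
    using card3 by simp
  then obtain a b where "t - {v} = {a, b}"
    by (auto simp: card_2_iff)
  then have "{v, a, b} = t"
    using t by blast
  then have face: "{v, a, b} \<in> F"
    using t by simp
  have strict: "S g (i, j, k) < S f (i, j, k)"
    if "{i, j, k} \<in> F" "\<not> (x i = 0 \<and> x j = 0 \<and> x k = 0)" for i j k
    using face_monotone[OF assms(2,3) f[unfolded \<Omega>_def] g[unfolded \<Omega>_def] that(1)] that(2)
    unfolding S_def x_def \<Omega>_def prod.case by blast
  \<comment> \<open>Faces on which \<open>x\<close> vanishes at all corners contribute 0 on both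
    sides; a face containing \<open>v\<close> makes the inequality strict.\<close>
  have "sum (S g) ?T < sum (S f) ?T"
  proof (rule sum_strict_mono_ex1)
    have "S g (i, j, k) \<le> S f (i, j, k)" if "{i, j, k} \<in> F" for i j k
      using strict[OF that] by (cases "x i = 0 \<and> x j = 0 \<and> x k = 0") (auto simp: S_def)
    then show "\<forall>p\<in>?T. S g p \<le> S f p"
      by auto
    show "\<exists>p\<in>?T. S g p < S f p"
      using strict[OF face] face xv by blast
  qed simp
  \<comment> \<open>Weighting the curvatures by the angle differences \<open>x\<close> separates
    \<open>f\<close> from \<open>g\<close>, although their curvatures agree.\<close>
  then have "6 * (\<Sum>i\<in>UNIV. x i * curvature F (edge_length (d g)) i)
      < 6 * (\<Sum>i\<in>UNIV. x i * curvature F (edge_length (d f)) i)"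
    unfolding sum_curvature S_def .
  moreover have "curvature F (edge_length (d f)) i = curvature F (edge_length (d g)) i" for i
    using eq by (auto simp: vec_eq_iff)
  ultimately show False
    by simp
qed

end
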